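(* Let $1\le p<\infty$, let $\mathcal U$ be an operator ideal, and let $X$ and $Y$ be Banach spaces such that $Y$ has the Schur property. If $\mathcal M$ is a closed subspace of $\mathcal U(X,Y)$ such that for each $y^*\in Y^*$ the evaluation operator $\psi_{y^*}:\mathcal M\to X^*$, $\psi_{y^*}(T)=T^*(y^* )$, is Dunford-Pettis $p$-convergent on $\mathcal M$, then $\mathcal M$ has the $p$-$(DPrcP)$.
   Context: $\mathcal U(X,Y)\subseteq L(X,Y)$ is the component of the operator ideal $\mathcal U$ consisting of operators from $X$ to $Y$, with the operator norm; $\mathcal M$ carries the operator norm. A sequence $(x_n)_n$ in a normed space $E$ is weakly $p$-summable if $(x^*(x_n))_n\in\ell_p$ for every $x^*\in E^*$. A bounded set $K\subseteq E$ is a Dunford-Pettis set if every weakly null sequence in $E^*$ converges to $0$ uniformly on $K$. $E$ has the $p$-Dunford-Pettis relatively compact property ($p$-$(DPrcP)$) if every weakly $p$-summable sequence in $E$ whose set of terms is a Dunford-Pettis set is norm null. A bounded linear operator is Dunford-Pettis $p$-convergent if it takes every weakly $p$-summable sequence whose set of terms is a Dunford-Pettis set to a norm null sequence. A Banach space has the Schur property if weakly null sequences in it are norm null. *)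

theory Defs
  imports "HOL-Analysis.Analysis" "HOL-Algebra.Module"
begin

section \<open>Normed spaces as objects\<close>

text \<open>
  Operator ideals range over all Banach spaces, and the notions below are needed for a space of
  operators, its dual and its bidual. Normed spaces are therefore records with an explicit carrier.
  The underlying vector space is a module over the scalar field in the sense of HOL-Algebra; the
  ring multiplication and unit that its record type inherits play no role.

  The scalar field is a type \<open>'k\<close> of class \<^class>\<open>real_normed_field\<close>. By the theorems of Mazur and
  Ostrowski the instances of this class are, up to isometric isomorphism, exactly the real and the
  complex numbers.
\<close>

record ('k, 'a) nspace = "('k, 'a) module" +
  vnorm :: "'a \<Rightarrow> real"

definition scalar_field :: "'k::real_normed_field ring" where
  "scalar_field = \<lparr>carrier = UNIV, mult = (*), one = 1, zero = 0, add = (+)\<rparr>"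

definition normed_space :: "('k::real_normed_field, 'a) nspace \<Rightarrow> bool" where
  "normed_space E \<longleftrightarrow>
     module scalar_field E \<and>
     (\<forall>x\<in>carrier E. 0 \<le> vnorm E x) \<and>
     (\<forall>x\<in>carrier E. vnorm E x = 0 \<longrightarrow> x = \<zero>\<^bsub>E\<^esub>) \<and>
     (\<forall>a. \<forall>x\<in>carrier E. vnorm E (a \<odot>\<^bsub>E\<^esub> x) = norm a * vnorm E x) \<and>
     (\<forall>x\<in>carrier E. \<forall>y\<in>carrier E. vnorm E (x \<oplus>\<^bsub>E\<^esub> y) \<le> vnorm E x + vnorm E y)"

text \<open>The value 0 off the carrier is needed because \<^locale>\<open>Metric_space\<close> asks for non-negativity
  and symmetry everywhere.\<close>

definition vdist :: "('k, 'a) nspace \<Rightarrow> 'a \<Rightarrow> 'a \<Rightarrow> real" where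
  "vdist E x y = (if x \<in> carrier E \<and> y \<in> carrier E then vnorm E (x \<ominus>\<^bsub>E\<^esub> y) else 0)"

definition banach_space :: "('k::real_normed_field, 'a) nspace \<Rightarrow> bool" where
  "banach_space E \<longleftrightarrow> normed_space E \<and> Metric_space.mcomplete (carrier E) (vdist E)"

definition subspace_of :: "('k, 'a) nspace \<Rightarrow> 'a set \<Rightarrow> ('k, 'a) nspace" where
  "subspace_of E S = E\<lparr>carrier := S\<rparr>"

definition closed_subspace :: "('k::real_normed_field, 'a) nspace \<Rightarrow> 'a set \<Rightarrow> bool" where
  "closed_subspace E S \<longleftrightarrow>
     submodule S scalar_field E \<and>
     closedin (Metric_space.mtopology (carrier E) (vdist E)) S"

definition linear_span :: "('k::real_normed_field, 'a) nspace \<Rightarrow> 'a set \<Rightarrow> 'a set" where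
  "linear_span E B = \<Inter>{S. submodule S scalar_field E \<and> B \<subseteq> S}"

definition scalar_space :: "('k::real_normed_field, 'k) nspace" where
  "scalar_space =
     \<lparr>carrier = UNIV, mult = (*), one = 1, zero = 0, add = (+), smult = (*), vnorm = norm\<rparr>"


section \<open>Bounded operators\<close>

text \<open>Operators are \<^const>\<open>extensional\<close>, so that two operators are equal when they agree on the
  carrier.\<close>

definition bounded_operators ::
    "('k::real_normed_field, 'a) nspace \<Rightarrow> ('k, 'b) nspace \<Rightarrow> ('a \<Rightarrow> 'b) set" where
  "bounded_operators E F =
     {T \<in> carrier E \<rightarrow>\<^sub>E carrier F.
        (\<forall>x\<in>carrier E. \<forall>y\<in>carrier E. T (x \<oplus>\<^bsub>E\<^esub> y) = T x \<oplus>\<^bsub>F\<^esub> T y) \<and>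
        (\<forall>a. \<forall>x\<in>carrier E. T (a \<odot>\<^bsub>E\<^esub> x) = a \<odot>\<^bsub>F\<^esub> T x) \<and>
        (\<exists>C. \<forall>x\<in>carrier E. vnorm F (T x) \<le> C * vnorm E x)}"

definition operator_norm ::
    "('k::real_normed_field, 'a) nspace \<Rightarrow> ('k, 'b) nspace \<Rightarrow> ('a \<Rightarrow> 'b) \<Rightarrow> real" where
  "operator_norm E F T = (SUP x\<in>{x \<in> carrier E. vnorm E x \<le> 1}. vnorm F (T x))"

definition operator_space ::
    "('k::real_normed_field, 'a) nspace \<Rightarrow> ('k, 'b) nspace \<Rightarrow> ('k, 'a \<Rightarrow> 'b) nspace" where
  "operator_space E F =
     \<lparr>carrier = bounded_operators E F,
      mult = undefined,
      one = undefined,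
      zero = (\<lambda>x\<in>carrier E. \<zero>\<^bsub>F\<^esub>),
      add = (\<lambda>S T. \<lambda>x\<in>carrier E. S x \<oplus>\<^bsub>F\<^esub> T x),
      smult = (\<lambda>a T. \<lambda>x\<in>carrier E. a \<odot>\<^bsub>F\<^esub> T x),
      vnorm = operator_norm E F\<rparr>"

definition dual_space :: "('k::real_normed_field, 'a) nspace \<Rightarrow> ('k, 'a \<Rightarrow> 'k) nspace" where
  "dual_space E = operator_space E scalar_space"

definition adjoint_operator ::
    "('k::real_normed_field, 'a) nspace \<Rightarrow> ('k, 'b) nspace \<Rightarrow> ('a \<Rightarrow> 'b)
       \<Rightarrow> ('b \<Rightarrow> 'k) \<Rightarrow> ('a \<Rightarrow> 'k)" where
  "adjoint_operator E F T = (\<lambda>f\<in>carrier (dual_space F). \<lambda>x\<in>carrier E. f (T x))"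


section \<open>Operator ideals\<close>

definition finite_rank_operators ::
    "('k::real_normed_field, 'a) nspace \<Rightarrow> ('k, 'b) nspace \<Rightarrow> ('a \<Rightarrow> 'b) set" where
  "finite_rank_operators E F =
     {T \<in> bounded_operators E F.
        \<exists>B. finite B \<and> B \<subseteq> carrier F \<and> T ` carrier E \<subseteq> linear_span F B}"

text \<open>The class of all Banach spaces is rendered as the class of all Banach spaces whose carrier is
  a set of elements of the type \<open>'u\<close>. This type is arbitrary, so it can be chosen large enough for
  any given set of Banach spaces.\<close>

definition operator_ideal ::
    "(('k::real_normed_field, 'u) nspace \<Rightarrow> ('k, 'u) nspace \<Rightarrow> ('u \<Rightarrow> 'u) set) \<Rightarrow> bool" where
  "operator_ideal \<U> \<longleftrightarrow>
     (\<forall>E F. banach_space E \<longrightarrow> banach_space F \<longrightarrow>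
        submodule (\<U> E F) scalar_field (operator_space E F) \<and>
        finite_rank_operators E F \<subseteq> \<U> E F) \<and>
     (\<forall>E F G H. banach_space E \<longrightarrow> banach_space F \<longrightarrow> banach_space G \<longrightarrow> banach_space H \<longrightarrow>
        (\<forall>R\<in>bounded_operators E F. \<forall>T\<in>\<U> F G. \<forall>S\<in>bounded_operators G H.
           compose (carrier E) S (compose (carrier E) T R) \<in> \<U> E H))"


section \<open>Weak summability and Dunford-Pettis notions\<close>

definition norm_null :: "('k, 'a) nspace \<Rightarrow> (nat \<Rightarrow> 'a) \<Rightarrow> bool" where
  "norm_null E x \<longleftrightarrow> (\<forall>n. x n \<in> carrier E) \<and> (\<lambda>n. vnorm E (x n)) \<longlonglongrightarrow> 0"

definition weakly_null :: "('k::real_normed_field, 'a) nspace \<Rightarrow> (nat \<Rightarrow> 'a) \<Rightarrow> bool" where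
  "weakly_null E x \<longleftrightarrow>
     (\<forall>n. x n \<in> carrier E) \<and> (\<forall>f\<in>carrier (dual_space E). (\<lambda>n. f (x n)) \<longlonglongrightarrow> 0)"

definition weakly_p_summable ::
    "real \<Rightarrow> ('k::real_normed_field, 'a) nspace \<Rightarrow> (nat \<Rightarrow> 'a) \<Rightarrow> bool" where
  "weakly_p_summable p E x \<longleftrightarrow>
     (\<forall>n. x n \<in> carrier E) \<and>
     (\<forall>f\<in>carrier (dual_space E). summable (\<lambda>n. norm (f (x n)) powr p))"

definition Dunford_Pettis_set :: "('k::real_normed_field, 'a) nspace \<Rightarrow> 'a set \<Rightarrow> bool" where
  "Dunford_Pettis_set E K \<longleftrightarrow>
     K \<subseteq> carrier E \<and> (\<exists>C. \<forall>x\<in>K. vnorm E x \<le> C) \<and>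
     (\<forall>f. weakly_null (dual_space E) f \<longrightarrow> uniform_limit K f (\<lambda>_. 0) sequentially)"

definition p_DPrcP :: "real \<Rightarrow> ('k::real_normed_field, 'a) nspace \<Rightarrow> bool" where
  "p_DPrcP p E \<longleftrightarrow>
     (\<forall>x. weakly_p_summable p E x \<and> Dunford_Pettis_set E (range x) \<longrightarrow> norm_null E x)"

definition Dunford_Pettis_p_convergent ::
    "real \<Rightarrow> ('k::real_normed_field, 'a) nspace \<Rightarrow> ('k, 'b) nspace \<Rightarrow> ('a \<Rightarrow> 'b) \<Rightarrow> bool" where
  "Dunford_Pettis_p_convergent p E F T \<longleftrightarrow>
     T \<in> bounded_operators E F \<and>
     (\<forall>x. weakly_p_summable p E x \<and> Dunford_Pettis_set E (range x) \<longrightarrow>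
        norm_null F (\<lambda>n. T (x n)))"

definition Schur_property :: "('k::real_normed_field, 'a) nspace \<Rightarrow> bool" where
  "Schur_property E \<longleftrightarrow> (\<forall>x. weakly_null E x \<longrightarrow> norm_null E x)"

definition evaluation_operator ::
    "('k::real_normed_field, 'a) nspace \<Rightarrow> ('k, 'b) nspace \<Rightarrow> ('a \<Rightarrow> 'b) set
       \<Rightarrow> ('b \<Rightarrow> 'k) \<Rightarrow> ('a \<Rightarrow> 'b) \<Rightarrow> ('a \<Rightarrow> 'k)" where
  "evaluation_operator X Y M f = (\<lambda>T\<in>M. adjoint_operator X Y T f)"

end

theory Submission
  imports Defs
begin

text \<open>
  The norm of an operator \<open>T\<^sub>n\<close> is almost attained at some point \<open>x\<^sub>n\<close> of the unit ball of \<open>X\<close>, so it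
  suffices to show that \<open>T\<^sub>n x\<^sub>n\<close> is norm null in \<open>Y\<close>. By the Schur property it is enough to test this
  weakly, and a functional \<open>f\<close> on \<open>Y\<close> satisfies \<open>\<bar>f (T\<^sub>n x\<^sub>n)\<bar> \<le> \<parallel>T\<^sub>n\<^sup>* f\<parallel>\<close> because \<open>x\<^sub>n\<close> lies in the
  unit ball. The right-hand side is the norm of \<open>\<psi>\<^sub>f(T\<^sub>n)\<close>, where \<open>\<psi>\<^sub>f\<close> is the evaluation operator
  at \<open>f\<close>. It tends to \<open>0\<close> by the Dunford-Pettis \<open>p\<close>-convergence of \<open>\<psi>\<^sub>f\<close> whenever \<open>(T\<^sub>n)\<close> is weakly
  \<open>p\<close>-summable with a Dunford-Pettis set of terms. The points \<open>x\<^sub>n\<close> come from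
  \<open>operator_norm_almost_attained\<close>; the passage from the adjoints to the operators themselves is
  \<open>operators_norm_null_if_adjoints_norm_null\<close>.
\<close>

lemma zero_in_unit_ball:
  fixes E :: "('k::real_normed_field, 'a) nspace"
  assumes "normed_space E"
  shows "\<zero>\<^bsub>E\<^esub> \<in> {x \<in> carrier E. vnorm E x \<le> 1}"
proof -
  have m: "module scalar_field E"
    and h: "\<And>a x. x \<in> carrier E \<Longrightarrow> vnorm E (a \<odot>\<^bsub>E\<^esub> x) = norm a * vnorm E x"
    using assms by (auto simp: normed_space_def)
  interpret module scalar_field E by (fact m)
  have "(0::'k) \<odot>\<^bsub>E\<^esub> \<zero>\<^bsub>E\<^esub> = \<zero>\<^bsub>E\<^esub>"
    by (rule smult_r_null) (simp add: scalar_field_def)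
  with h[of "\<zero>\<^bsub>E\<^esub>" 0] show ?thesis by simp
qed

lemma bdd_above_operator_values:
  assumes "normed_space E" and "T \<in> bounded_operators E F"
  shows "bdd_above ((\<lambda>x. vnorm F (T x)) ` {x \<in> carrier E. vnorm E x \<le> 1})"
proof -
  obtain C where C: "\<And>x. x \<in> carrier E \<Longrightarrow> vnorm F (T x) \<le> C * vnorm E x"
    using assms(2) unfolding bounded_operators_def by blast
  have "vnorm F (T x) \<le> \<bar>C\<bar>" if "x \<in> carrier E" "vnorm E x \<le> 1" for x
  proof -
    have "0 \<le> vnorm E x"
      using assms(1) that(1) by (simp add: normed_space_def)
    then have "C * vnorm E x \<le> \<bar>C\<bar> * vnorm E x"
      by (intro mult_right_mono) auto
    also have "\<dots> \<le> \<bar>C\<bar>"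
      using that(2) by (simp add: mult_left_le)
    finally show ?thesis
      using C[OF that(1)] by linarith
  qed
  then show ?thesis
    by (intro bdd_aboveI[where M = "\<bar>C\<bar>"]) auto
qed

lemma vnorm_le_operator_norm:
  assumes "normed_space E" and "T \<in> bounded_operators E F"
    and "x \<in> carrier E" and "vnorm E x \<le> 1"
  shows "vnorm F (T x) \<le> operator_norm E F T"
  unfolding operator_norm_def
  using assms by (intro cSUP_upper bdd_above_operator_values) auto

lemma operator_norm_almost_attained:
  assumes "normed_space E" and "T \<in> bounded_operators E F" and "0 < e"
  obtains x where "x \<in> carrier E" and "vnorm E x \<le> 1"
    and "operator_norm E F T < vnorm F (T x) + e"
proof -
  have "operator_norm E F T - e < (SUP x\<in>{x \<in> carrier E. vnorm E x \<le> 1}. vnorm F (T x))"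
    using assms(3) by (simp add: operator_norm_def)
  then have "\<exists>x\<in>{x \<in> carrier E. vnorm E x \<le> 1}. operator_norm E F T - e < vnorm F (T x)"
    using zero_in_unit_ball[OF assms(1)] bdd_above_operator_values[OF assms(1,2)]
    by (subst (asm) less_cSUP_iff) auto
  then show thesis
    using that by (force simp: algebra_simps)
qed

lemma norm_functional_le_adjoint_norm:
  fixes E :: "('k::real_normed_field, 'a) nspace"
  assumes "normed_space E"
    and "f \<in> carrier (dual_space F)"
    and "adjoint_operator E F T f \<in> carrier (dual_space E)"
    and "x \<in> carrier E" and "vnorm E x \<le> 1"
  shows "norm (f (T x)) \<le> vnorm (dual_space E) (adjoint_operator E F T f)"
proof -
  have "adjoint_operator E F T f \<in> bounded_operators E scalar_space"
    using assms(3) by (simp add: dual_space_def operator_space_def)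
  from vnorm_le_operator_norm[OF assms(1) this assms(4,5)] show ?thesis
    using assms(2,4)
    by (simp add: adjoint_operator_def dual_space_def operator_space_def scalar_space_def)
qed

text \<open>
  Norm convergence of \<open>T\<^sub>n\<^sup>* f\<close> is convergence of \<open>f (T\<^sub>n x)\<close> uniformly in \<open>x\<close> in the unit ball, for each
  \<open>f\<close> separately. Uniformity in \<open>x\<close> allows \<open>x\<close> to vary with \<open>n\<close>, in particular to be an almost norming
  point of \<open>T\<^sub>n\<close>; the Schur property then supplies the missing uniformity in \<open>f\<close>.
\<close>

lemma operators_norm_null_if_adjoints_norm_null:
  fixes X :: "('k::real_normed_field, 'a) nspace" and Y :: "('k, 'b) nspace"
  assumes X: "normed_space X" and Y: "normed_space Y" and Schur: "Schur_property Y"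
    and T: "\<And>n. T n \<in> bounded_operators X Y"
    and adj: "\<And>f. f \<in> carrier (dual_space Y) \<Longrightarrow>
                norm_null (dual_space X) (\<lambda>n. adjoint_operator X Y (T n) f)"
  shows "(\<lambda>n. operator_norm X Y (T n)) \<longlonglongrightarrow> 0"
proof -
  have "\<exists>x. x \<in> carrier X \<and> vnorm X x \<le> 1 \<and>
          operator_norm X Y (T n) < vnorm Y (T n x) + inverse (real (Suc n))" for n
    using operator_norm_almost_attained[OF X T, of "inverse (real (Suc n))" n] by auto
  then obtain x where x: "\<And>n. x n \<in> carrier X" "\<And>n. vnorm X (x n) \<le> 1"
    and near: "\<And>n. operator_norm X Y (T n) < vnorm Y (T n (x n)) + inverse (real (Suc n))"
    by metis
  have Tx: "T n (x n) \<in> carrier Y" for n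
    using T[of n] x(1)[of n] by (auto simp: bounded_operators_def)
  have "(\<lambda>n. f (T n (x n))) \<longlonglongrightarrow> 0" if f: "f \<in> carrier (dual_space Y)" for f
  proof (rule Lim_null_comparison)
    show "(\<lambda>n. vnorm (dual_space X) (adjoint_operator X Y (T n) f)) \<longlonglongrightarrow> 0"
      using adj[OF f] by (simp add: norm_null_def)
    show "\<forall>\<^sub>F n in sequentially.
        norm (f (T n (x n))) \<le> vnorm (dual_space X) (adjoint_operator X Y (T n) f)"
      using adj[OF f] x
      by (intro always_eventually allI norm_functional_le_adjoint_norm[OF X f])
        (auto simp: norm_null_def)
  qed
  with Tx have "weakly_null Y (\<lambda>n. T n (x n))"
    by (simp add: weakly_null_def)
  with Schur have "(\<lambda>n. vnorm Y (T n (x n))) \<longlonglongrightarrow> 0"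
    by (simp add: Schur_property_def norm_null_def)
  from tendsto_add[OF this LIMSEQ_inverse_real_of_nat]
  have lim: "(\<lambda>n. vnorm Y (T n (x n)) + inverse (real (Suc n))) \<longlonglongrightarrow> 0"
    by simp
  have nonneg: "0 \<le> operator_norm X Y (T n)" for n
  proof -
    have "0 \<le> vnorm Y (T n (x n))"
      using Y Tx by (simp add: normed_space_def)
    also have "\<dots> \<le> operator_norm X Y (T n)"
      by (rule vnorm_le_operator_norm[OF X T x])
    finally show ?thesis .
  qed
  show ?thesis
    by (rule tendsto_sandwich[OF _ _ tendsto_const lim])
      (use nonneg less_imp_le[OF near] in \<open>auto intro!: always_eventually\<close>)
qed

theorem theorem3p10:
  fixes p :: real
    and \<U> :: "('k::real_normed_field, 'u) nspace \<Rightarrow> ('k, 'u) nspace \<Rightarrow> ('u \<Rightarrow> 'u) set"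
    and X Y :: "('k, 'u) nspace"
    and M :: "('u \<Rightarrow> 'u) set"
  assumes "1 \<le> p"
    and "operator_ideal \<U>"
    and "banach_space X"
    and "banach_space Y"
    and "Schur_property Y"
    and "closed_subspace (subspace_of (operator_space X Y) (\<U> X Y)) M"
    and "\<And>f. f \<in> carrier (dual_space Y) \<Longrightarrow>
           Dunford_Pettis_p_convergent p (subspace_of (operator_space X Y) M) (dual_space X)
             (evaluation_operator X Y M f)"
  shows "p_DPrcP p (subspace_of (operator_space X Y) M)"
proof -
  let ?M = "subspace_of (operator_space X Y) M"
  have X: "normed_space X" and Y: "normed_space Y"
    using assms(3,4) by (auto simp: banach_space_def)
  have "submodule (\<U> X Y) scalar_field (operator_space X Y)"
    using assms(2-4) by (simp add: operator_ideal_def)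
  then have "\<U> X Y \<subseteq> bounded_operators X Y"
    by (auto dest!: submodule.axioms(1) subgroup.subset simp: operator_space_def)
  moreover have "M \<subseteq> \<U> X Y"
    using assms(6) unfolding closed_subspace_def
    by (auto dest!: submodule.axioms(1) subgroup.subset simp: subspace_of_def)
  ultimately have M: "M \<subseteq> bounded_operators X Y" by blast
  have "norm_null ?M T" if T: "weakly_p_summable p ?M T" "Dunford_Pettis_set ?M (range T)" for T
  proof -
    have TM: "T n \<in> M" for n
      using T(1) by (simp add: weakly_p_summable_def subspace_of_def)
    have "norm_null (dual_space X) (\<lambda>n. adjoint_operator X Y (T n) f)"
      if "f \<in> carrier (dual_space Y)" for f
    proof -
      have "norm_null (dual_space X) (\<lambda>n. evaluation_operator X Y M f (T n))"
        using assms(7)[OF that] T by (simp add: Dunford_Pettis_p_convergent_def)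
      then show ?thesis
        using TM by (simp add: evaluation_operator_def)
    qed
    then have "(\<lambda>n. operator_norm X Y (T n)) \<longlonglongrightarrow> 0"
      using TM M by (intro operators_norm_null_if_adjoints_norm_null[OF X Y assms(5)]) auto
    then show ?thesis
      using TM by (simp add: norm_null_def subspace_of_def operator_space_def)
  qed
  then show ?thesis
    by (simp add: p_DPrcP_def)
qed

end
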